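(* Let $X$ be a real Banach space and let $C\subset X$ be a closed convex subset which is dentable with respect to a complete metric $d$ defined on $C$. Assume moreover that $d$ is uniformly continuous on bounded sets with respect to the norm and that $d$ induces the norm topology on $C$. Then $C$ has the Radon–Nikodým property.
   Context: An open half-space of $X$ is a set $\{x\in X: x^*(x)>a\}$ with $x^*\in X^*$, $a\in\mathbb R$. "Bounded" refers to the norm. $C$ is dentable with respect to a metric $d$ on $C$ if for every nonempty bounded $A\subset C$ and every $\varepsilon>0$ there is an open half-space $H$ with $A\cap H\neq\emptyset$ and $d$-diameter of $A\cap H$ less than $\varepsilon$. The metric $d$ is uniformly continuous on bounded sets with respect to the norm if for every bounded $B\subset C$ and every $\varepsilon>0$ there is $\delta>0$ such that $d(x,y)<\varepsilon$ whenever $x,y\in B$ and $\|x-y\|<\delta$. A closed convex set $C$ has the Radon–Nikodým property (RNP) if and only if (Rieffel's characterisation, which may be taken as the definition) it is dentable with respect to the norm metric. *)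

theory Defs
  imports "HOL-Analysis.Analysis"
begin

definition open_halfspace :: "'a::real_normed_vector set \<Rightarrow> bool" where
  "open_halfspace H \<longleftrightarrow> (\<exists>(f :: 'a \<Rightarrow>\<^sub>L real) (a :: real). H = {x. blinfun_apply f x > a})"

(* Valued in ennreal, because the library's diameter is 0 on unbounded sets and is
   tied to the type-class distance. *)
definition ediam :: "('a \<Rightarrow> 'a \<Rightarrow> real) \<Rightarrow> 'a set \<Rightarrow> ennreal" where
  "ediam d S = (SUP x\<in>S. SUP y\<in>S. ennreal (d x y))"

(* Boundedness of A is with respect to the norm, also when d is another metric. *)
definition dentable :: "'a::real_normed_vector set \<Rightarrow> ('a \<Rightarrow> 'a \<Rightarrow> real) \<Rightarrow> bool" where
  "dentable C d \<longleftrightarrow>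
    (\<forall>A (\<epsilon>::real). A \<subseteq> C \<and> A \<noteq> {} \<and> bounded A \<and> \<epsilon> > 0 \<longrightarrow>
      (\<exists>H. open_halfspace H \<and> A \<inter> H \<noteq> {} \<and> ediam d (A \<inter> H) < ennreal \<epsilon>))"

definition uniformly_continuous_on_bounded_sets ::
    "'a::real_normed_vector set \<Rightarrow> ('a \<Rightarrow> 'a \<Rightarrow> real) \<Rightarrow> bool" where
  "uniformly_continuous_on_bounded_sets C d \<longleftrightarrow>
    (\<forall>B (\<epsilon>::real). B \<subseteq> C \<and> bounded B \<and> \<epsilon> > 0 \<longrightarrow>
      (\<exists>\<delta>>0. \<forall>x\<in>B. \<forall>y\<in>B. norm (x - y) < \<delta> \<longrightarrow> d x y < \<epsilon>))"

(* Rieffel's characterisation taken as the definition; intended for closed convex C. *)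
definition radon_nikodym_property :: "'a::real_normed_vector set \<Rightarrow> bool" where
  "radon_nikodym_property C \<longleftrightarrow> dentable C (\<lambda>x y. norm (x - y))"

end

theory Submission
  imports Defs
begin

text \<open>Every slice of a bounded closed convex set \<open>K \<subseteq> C\<close> contains a slice of \<open>K\<close> of small
  \<open>d\<close>-diameter. Otherwise, by Hahn-Banach, each point \<open>x\<close> of some slice \<open>S\<close> is nearly a convex
  combination of points of \<open>K - S\<close> and of points of \<open>S\<close> that are \<open>d\<close>-far from \<open>x\<close>. This yields a
  Markov chain on \<open>S\<close>, killed on leaving \<open>S\<close>, whose steps are \<open>d\<close>-large and almost preserve the
  mean. Conditioned on surviving forever, it has exact barycenters, which are norm-close to the
  states with survival probability near \<open>1\<close>. A slice of the set of barycenters then always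
  contains the barycenters of two consecutive such states, so no slice of it is \<open>d\<close>-small, against
  dentability.

  Hence a bounded \<open>A \<subseteq> C\<close> admits decreasing slices of the closed convex hull of \<open>A\<close> with
  \<open>d\<close>-diameters tending to \<open>0\<close>. They shrink to a point in \<open>d\<close> by completeness, therefore also in
  norm, and each of them meets \<open>A\<close>.\<close>

subsection \<open>Hahn-Banach separation\<close>

text \<open>Homogeneity is only an inequality for \<open>t > 0\<close>, a form that passes easily to
  infima; equality follows by rescaling with \<open>1/t\<close>.\<close>

definition sublinear :: "('a::real_vector \<Rightarrow> real) \<Rightarrow> bool" where
  "sublinear p \<longleftrightarrow> (\<forall>x y. p (x + y) \<le> p x + p y) \<and> (\<forall>x t. t > 0 \<longrightarrow> p (t *\<^sub>R x) \<le> t * p x)"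

lemma sublinearD:
  assumes "sublinear p"
  shows "p (x + y) \<le> p x + p y" and "t > 0 \<Longrightarrow> p (t *\<^sub>R x) \<le> t * p x"
  using assms by (auto simp: sublinear_def)

lemma sublinear_0: "sublinear p \<Longrightarrow> p 0 = 0"
  using sublinearD(1)[of p 0 0] sublinearD(2)[of p "1/2" 0] by simp

lemma sublinear_scale:
  assumes p: "sublinear p" and "t \<ge> 0"
  shows "p (t *\<^sub>R x) = t * p x"
proof (cases "t = 0")
  case False
  then have t: "t > 0" using assms by simp
  have "p ((1/t) *\<^sub>R (t *\<^sub>R x)) \<le> (1/t) * p (t *\<^sub>R x)"
    using p t by (intro sublinearD) auto
  then have "t * p x \<le> p (t *\<^sub>R x)" using t by (simp add: field_simps)
  with sublinearD(2)[OF p t] show ?thesis by (simp add: antisym)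
qed (use sublinear_0[OF p] in simp)

lemma sublinear_minus: "sublinear p \<Longrightarrow> - p (- x) \<le> p x"
  using sublinearD(1)[of p x "- x"] sublinear_0[of p] by simp

text \<open>Subadditivity needs one functional for both summands: the smaller of two members of the
  chain.\<close>

lemma sublinear_INF_chain:
  assumes ne: "Q \<noteq> {}" and sub: "\<And>q. q \<in> Q \<Longrightarrow> sublinear q"
    and bdd: "\<And>x. bdd_below ((\<lambda>q. q x) ` Q)"
    and chain: "\<And>q r. q \<in> Q \<Longrightarrow> r \<in> Q \<Longrightarrow> q \<le> r \<or> r \<le> q"
  shows "sublinear (\<lambda>x. INF q\<in>Q. q x)"
  unfolding sublinear_def
proof safe
  fix x y
  let ?u = "\<lambda>x. INF q\<in>Q. q x"
  have 1: "?u (x + y) \<le> q x + r y" if q: "q \<in> Q" and r: "r \<in> Q" for q r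
  proof -
    from chain[OF q r] obtain m where m: "m \<in> Q" "m \<le> q" "m \<le> r" using q r by blast
    have "?u (x + y) \<le> m (x + y)" by (rule cINF_lower[OF bdd m(1)])
    also have "\<dots> \<le> m x + m y" by (rule sublinearD(1)[OF sub[OF m(1)]])
    also have "\<dots> \<le> q x + r y" using m by (simp add: add_mono le_funD)
    finally show ?thesis .
  qed
  have "?u (x + y) - q x \<le> ?u y" if q: "q \<in> Q" for q
    by (rule cINF_greatest[OF ne]) (use 1[OF q] in \<open>simp add: algebra_simps\<close>)
  then have "?u (x + y) - ?u y \<le> ?u x"
    by (intro cINF_greatest[OF ne]) (simp add: algebra_simps)
  then show "?u (x + y) \<le> ?u x + ?u y" by simp
next
  fix x and t :: real assume t: "t > 0"
  let ?u = "\<lambda>x. INF q\<in>Q. q x"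
  have "?u (t *\<^sub>R x) / t \<le> q x" if q: "q \<in> Q" for q
  proof -
    have "?u (t *\<^sub>R x) \<le> q (t *\<^sub>R x)" by (rule cINF_lower[OF bdd q])
    also have "\<dots> \<le> t * q x" by (rule sublinearD(2)[OF sub[OF q] t])
    finally show ?thesis using t by (simp add: field_simps)
  qed
  then have "?u (t *\<^sub>R x) / t \<le> ?u x" by (intro cINF_greatest[OF ne])
  then show "?u (t *\<^sub>R x) \<le> t * ?u x" using t by (simp add: field_simps)
qed

text \<open>Zorn's lemma for the reversed pointwise order. Chains have finite infima because
  \<open>- p (- x) \<le> - q (- x) \<le> q x\<close> for every sublinear
  \<open>q \<le> p\<close>.\<close>

lemma minimal_sublinear_ex:
  assumes p: "sublinear p"
  obtains q where "sublinear q" "q \<le> p" "\<And>r. sublinear r \<Longrightarrow> r \<le> q \<Longrightarrow> r = q"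
proof -
  let ?A = "{q. sublinear q \<and> q \<le> p}"
  have "\<exists>m\<in>?A. \<forall>a\<in>?A. a \<le> m \<longrightarrow> a = m"
  proof (rule predicate_Zorn)
    show "partial_order_on ?A (relation_of (\<lambda>a b. b \<le> a) ?A)"
      by (rule partial_order_on_relation_ofI) auto
    fix Q assume Q: "Q \<in> Chains (relation_of (\<lambda>a b. b \<le> a) ?A)"
    then have QA: "Q \<subseteq> ?A" and ch: "\<And>q r. q \<in> Q \<Longrightarrow> r \<in> Q \<Longrightarrow> q \<le> r \<or> r \<le> q"
      by (auto simp: Chains_def relation_of_def)
    show "\<exists>u\<in>?A. \<forall>a\<in>Q. u \<le> a"
    proof (cases "Q = {}")
      case True
      then show ?thesis using p by auto
    next
      case False
      have bdd: "bdd_below ((\<lambda>q. q x) ` Q)" for x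
      proof (rule bdd_belowI2)
        fix q assume "q \<in> Q"
        then have "sublinear q" "q (- x) \<le> p (- x)" using QA by (auto simp: le_fun_def)
        then show "- p (- x) \<le> q x" using sublinear_minus[of q x] by simp
      qed
      let ?u = "\<lambda>x. INF q\<in>Q. q x"
      have "sublinear ?u" using QA by (intro sublinear_INF_chain False bdd ch) auto
      moreover have lower: "?u \<le> q" if "q \<in> Q" for q
        using that by (auto simp: le_fun_def intro: cINF_lower bdd)
      moreover have "?u \<le> p" using False QA lower by (blast intro: order_trans)
      ultimately show ?thesis by blast
    qed
  qed
  then obtain q where q: "sublinear q" "q \<le> p"
    and min: "\<And>r. sublinear r \<Longrightarrow> r \<le> p \<Longrightarrow> r \<le> q \<Longrightarrow> r = q" by blast
  show thesis by (rule that[OF q]) (use min q(2) order_trans in blast)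
qed

text \<open>Lowering \<open>q\<close> along the ray spanned by \<open>y\<close> gives a sublinear
  \<open>r \<le> q\<close>. By minimality \<open>r = q\<close>, and the competitor
  \<open>t = 1\<close> in the infimum is the missing half of additivity.\<close>

lemma minimal_sublinear_additive:
  assumes q: "sublinear q" and min: "\<And>r. sublinear r \<Longrightarrow> r \<le> q \<Longrightarrow> r = q"
  shows "q (x + y) = q x + q y"
proof -
  define r where "r = (\<lambda>x. INF t\<in>{0..}. q (x + t *\<^sub>R y) - t * q y)"
  have bdd: "bdd_below ((\<lambda>t. q (x + t *\<^sub>R y) - t * q y) ` {0..})" for x
  proof (rule bdd_belowI2)
    fix t :: real assume "t \<in> {0..}"
    then have "q (t *\<^sub>R y) = t * q y" using sublinear_scale[OF q] by simp
    then show "- q (- x) \<le> q (x + t *\<^sub>R y) - t * q y"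
      using sublinearD(1)[OF q, of "x + t *\<^sub>R y" "- x"] by simp
  qed
  have r_le: "r x \<le> q (x + t *\<^sub>R y) - t * q y" if "t \<ge> 0" for x t
    unfolding r_def using that by (intro cINF_lower bdd) simp
  have le_r: "c \<le> r x" if "\<And>t. t \<ge> 0 \<Longrightarrow> c \<le> q (x + t *\<^sub>R y) - t * q y" for x c
    unfolding r_def using that by (intro cINF_greatest) auto
  have "sublinear r"
    unfolding sublinear_def
  proof safe
    fix u v
    have 1: "r (u + v) \<le> (q (u + s *\<^sub>R y) - s * q y) + (q (v + t *\<^sub>R y) - t * q y)"
      if "s \<ge> 0" "t \<ge> 0" for s t
    proof -
      have "r (u + v) \<le> q (u + v + (s + t) *\<^sub>R y) - (s + t) * q y"
        using that by (intro r_le) simp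
      also have "u + v + (s + t) *\<^sub>R y = (u + s *\<^sub>R y) + (v + t *\<^sub>R y)"
        by (simp add: algebra_simps)
      finally show ?thesis
        using sublinearD(1)[OF q, of "u + s *\<^sub>R y" "v + t *\<^sub>R y"] by (simp add: algebra_simps)
    qed
    have "r (u + v) - (q (u + s *\<^sub>R y) - s * q y) \<le> r v" if "s \<ge> 0" for s
      by (rule le_r) (use 1[OF that] in \<open>simp add: algebra_simps\<close>)
    then have "r (u + v) - r v \<le> r u" by (intro le_r) (simp add: algebra_simps)
    then show "r (u + v) \<le> r u + r v" by simp
  next
    fix u and s :: real assume s: "s > 0"
    have "r (s *\<^sub>R u) / s \<le> r u"
    proof (rule le_r)
      fix t :: real assume t: "t \<ge> 0"
      have "r (s *\<^sub>R u) \<le> q (s *\<^sub>R u + (s * t) *\<^sub>R y) - (s * t) * q y"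
        using s t by (intro r_le) simp
      also have "s *\<^sub>R u + (s * t) *\<^sub>R y = s *\<^sub>R (u + t *\<^sub>R y)"
        by (simp add: algebra_simps)
      also have "q \<dots> = s * q (u + t *\<^sub>R y)" using s by (intro sublinear_scale[OF q]) simp
      finally show "r (s *\<^sub>R u) / s \<le> q (u + t *\<^sub>R y) - t * q y"
        using s by (simp add: field_simps)
    qed
    then show "r (s *\<^sub>R u) \<le> s * r u" using s by (simp add: field_simps)
  qed
  moreover have "r \<le> q" using r_le[of 0] by (simp add: le_fun_def)
  ultimately have "r = q" by (rule min)
  then have "q x \<le> q (x + y) - q y" using r_le[of 1 x] by simp
  then show ?thesis using sublinearD(1)[OF q, of x y] by simp
qed

text \<open>A minimal sublinear functional below \<open>p\<close> is additive, hence odd, and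
  oddness extends homogeneity to negative scalars.\<close>

theorem hahn_banach_sublinear:
  assumes "sublinear p"
  obtains f where "linear f" "\<And>x. f x \<le> p x"
proof -
  obtain q where q: "sublinear q" "q \<le> p" and min: "\<And>r. sublinear r \<Longrightarrow> r \<le> q \<Longrightarrow> r = q"
    using minimal_sublinear_ex[OF assms] by blast
  note add = minimal_sublinear_additive[OF q(1) min]
  have neg: "q (- x) = - q x" for x
    using add[of x "- x"] sublinear_0[OF q(1)] by simp
  have "linear q"
  proof (rule linearI)
    show "q (t *\<^sub>R x) = t *\<^sub>R q x" for t x
    proof (cases "t \<ge> 0")
      case False
      then have "q (- (- t *\<^sub>R x)) = - (- t * q x)"
        unfolding neg by (subst sublinear_scale[OF q(1)]) auto
      then show ?thesis by simp
    qed (simp add: sublinear_scale[OF q(1)])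
  qed (rule add)
  then show thesis using that q(2) by (auto simp: le_fun_def)
qed

text \<open>Hahn-Banach is applied to the largest sublinear functional that is dominated by the norm
  and by \<open>-r\<close> on the translate \<open>D - x\<close>, where \<open>r\<close> is the distance of \<open>x\<close> to \<open>D\<close>.\<close>

theorem hahn_banach_separation:
  fixes D :: "'a::real_normed_vector set"
  assumes "closed D" "convex D" "x \<notin> D"
  obtains f :: "'a \<Rightarrow>\<^sub>L real" and a where "blinfun_apply f x > a" "\<And>y. y \<in> D \<Longrightarrow> blinfun_apply f y \<le> a"
proof (cases "D = {}")
  case True
  then show thesis using that[of "-1" 0] by simp
next
  case False
  obtain r where r: "r > 0" and dist: "\<And>y. y \<in> D \<Longrightarrow> r \<le> norm (y - x)"
  proof -
    have "open (- D)" "x \<in> - D" using assms by auto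
    then obtain r where "r > 0" "ball x r \<subseteq> - D" by (meson open_contains_ball)
    moreover from this have "r \<le> norm (y - x)" if "y \<in> D" for y
      using that by (force simp: dist_norm norm_minus_commute)
    ultimately show thesis using that by blast
  qed
  define I where "I = {0::real..} \<times> D"
  \<comment> \<open>The vectors \<open>t *\<^sub>R (y - x)\<close> run through the cone over
    \<open>D - x\<close>. Taking \<open>t = 0\<close> gives \<open>p v \<le> norm v\<close>; taking
    \<open>t = 1\<close>, \<open>v = y - x\<close> gives \<open>p (y - x) \<le> - r\<close>. The
    distance bound keeps the infimum above \<open>- norm v\<close>.\<close>
  define g where "g = (\<lambda>v (t, y). norm (v - t *\<^sub>R (y - x)) - t * r)"
  define p where "p = (\<lambda>v. INF i\<in>I. g v i)"
  have Ine: "I \<noteq> {}" using False by (auto simp: I_def)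
  have bdd: "bdd_below (g v ` I)" for v
  proof (rule bdd_belowI2)
    fix i assume "i \<in> I"
    then obtain t y where i: "i = (t, y)" "t \<ge> 0" "y \<in> D" by (auto simp: I_def)
    have "t * r \<le> norm (t *\<^sub>R (y - x))" using i dist by (simp add: mult_left_mono)
    also have "\<dots> \<le> norm (v - t *\<^sub>R (y - x)) + norm v"
      by (metis norm_minus_commute norm_triangle_sub add.commute)
    finally show "- norm v \<le> g v i" by (simp add: g_def i)
  qed
  have p_le: "p v \<le> g v (t, y)" if "t \<ge> 0" "y \<in> D" for v t y
    unfolding p_def using that by (intro cINF_lower bdd) (auto simp: I_def)
  have le_p: "c \<le> p v" if "\<And>t y. t \<ge> 0 \<Longrightarrow> y \<in> D \<Longrightarrow> c \<le> g v (t, y)" for v c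
    unfolding p_def using that by (intro cINF_greatest Ine) (auto simp: I_def)
  have "sublinear p"
    unfolding sublinear_def
  proof safe
    fix u v
    have 1: "p (u + v) \<le> g u (s, y) + g v (t, z)"
      if "s \<ge> 0" "t \<ge> 0" "y \<in> D" "z \<in> D" for s t y z
    proof (cases "s + t = 0")
      case True
      then have "s = 0" "t = 0" using that by auto
      then show ?thesis using p_le[of 0 y "u + v"] that norm_triangle_ineq[of u v] by (simp add: g_def)
    next
      case False
      then have st: "s + t > 0" using that by simp
      \<comment> \<open>Convexity merges the two cone vectors into one with parameter
        \<open>s + t\<close>.\<close>
      define w where "w = (s / (s + t)) *\<^sub>R y + (t / (s + t)) *\<^sub>R z"
      have w: "w \<in> D" unfolding w_def using st that
        by (intro convexD[OF assms(2)]) (auto simp flip: add_divide_distrib)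
      have "(s + t) *\<^sub>R w = s *\<^sub>R y + t *\<^sub>R z" using st by (simp add: w_def scaleR_add_right)
      then have "(s + t) *\<^sub>R (w - x) = s *\<^sub>R (y - x) + t *\<^sub>R (z - x)"
        by (simp add: algebra_simps)
      then have "norm (u + v - (s + t) *\<^sub>R (w - x)) \<le>
          norm (u - s *\<^sub>R (y - x)) + norm (v - t *\<^sub>R (z - x))"
        by (metis norm_triangle_ineq add_diff_add)
      then show ?thesis using p_le[OF _ w, of "s + t" "u + v"] that
        by (simp add: g_def algebra_simps)
    qed
    have "p (u + v) - g u (s, y) \<le> p v" if "s \<ge> 0" "y \<in> D" for s y
      by (rule le_p) (use 1 that in \<open>simp add: algebra_simps\<close>)
    then have "p (u + v) - p v \<le> p u" by (intro le_p) (simp add: algebra_simps)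
    then show "p (u + v) \<le> p u + p v" by simp
  next
    fix v and s :: real assume s: "s > 0"
    have "p (s *\<^sub>R v) / s \<le> p v"
    proof (rule le_p)
      fix t :: real and y assume t: "t \<ge> 0" "y \<in> D"
      have "p (s *\<^sub>R v) \<le> g (s *\<^sub>R v) (s * t, y)" using s t by (intro p_le) auto
      also have "\<dots> = norm (s *\<^sub>R (v - t *\<^sub>R (y - x))) - s * t * r"
        by (simp add: g_def scaleR_diff_right)
      also have "\<dots> = s * g v (t, y)"
        unfolding norm_scaleR using s by (simp add: g_def right_diff_distrib)
      finally show "p (s *\<^sub>R v) / s \<le> g v (t, y)" using s by (simp add: field_simps)
    qed
    then show "p (s *\<^sub>R v) \<le> s * p v" using s by (simp add: field_simps)
  qed
  then obtain f where f: "linear f" and fp: "\<And>v. f v \<le> p v" using hahn_banach_sublinear by blast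
  have fn: "f v \<le> norm v" for v
    using fp[of v] p_le[of 0 _ v] False by (force simp: g_def)
  have "\<bar>f v\<bar> \<le> norm v" for v
    using fn[of v] fn[of "- v"] linear_neg[OF f] by (simp add: abs_le_iff)
  then have bl: "bounded_linear f"
    using f by (intro bounded_linear_intro[where K = 1]) (auto simp: linear_add linear_scale)
  have "f y \<le> f x - r" if "y \<in> D" for y
    using fp[of "y - x"] p_le[OF _ that, of 1 "y - x"] linear_diff[OF f] by (simp add: g_def)
  then show thesis
    using that[of "f x - r" "Blinfun f"] r by (simp add: bounded_linear_Blinfun_apply[OF bl])
qed

subsection \<open>Killed Markov chains\<close>

text \<open>The potential \<open>B\<close> decreases and is bounded below, so it is Cauchy, and its
  decrements dominate all distances between terms of \<open>a\<close>.\<close>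

lemma convergent_if_telescoping_bound:
  fixes a :: "nat \<Rightarrow> 'a::banach" and B :: "nat \<Rightarrow> real"
  assumes step: "\<And>k. norm (a (Suc k) - a k) \<le> B k - B (Suc k)" and nonneg: "\<And>k. 0 \<le> B k"
  obtains l b where "a \<longlonglongrightarrow> l" "B \<longlonglongrightarrow> b" "norm (a 0 - l) \<le> B 0 - b"
proof -
  have far: "norm (a k - a (k + j)) \<le> B k - B (k + j)" for k j
  proof (induction j)
    case (Suc j)
    have "norm (a k - a (k + Suc j)) \<le> norm (a k - a (k + j)) + norm (a (Suc (k + j)) - a (k + j))"
      using norm_triangle_ineq4[of "a k - a (k + j)" "a (Suc (k + j)) - a (k + j)"] by simp
    also have "\<dots> \<le> B k - B (k + Suc j)" using Suc step[of "k + j"] by simp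
    finally show ?case .
  qed simp
  have "decseq B" using order_trans[OF norm_ge_zero step] by (simp add: decseq_Suc_iff)
  then obtain b where b: "B \<longlonglongrightarrow> b" using decseq_convergent nonneg by blast
  have "Cauchy a"
  proof (rule CauchyI)
    fix e :: real assume "e > 0"
    then obtain N where N: "\<And>m n. m \<ge> N \<Longrightarrow> n \<ge> N \<Longrightarrow> norm (B m - B n) < e"
      using CauchyD[OF LIMSEQ_imp_Cauchy[OF b]] by blast
    have "norm (a m - a n) < e" if "N \<le> m" "m \<le> n" for m n
    proof -
      have "norm (a m - a n) \<le> B m - B n" using far[of m "n - m"] that by simp
      also have "\<dots> < e" using N[of m n] that by simp
      finally show ?thesis .
    qed
    then show "\<exists>N. \<forall>m\<ge>N. \<forall>n\<ge>N. norm (a m - a n) < e"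
      by (metis linorder_linear norm_minus_commute)
  qed
  then obtain l where l: "a \<longlonglongrightarrow> l" using Cauchy_convergent_iff convergent_def by blast
  have "norm (a 0 - l) \<le> B 0 - b"
  proof (rule LIMSEQ_le)
    show "(\<lambda>j. norm (a 0 - a j)) \<longlonglongrightarrow> norm (a 0 - l)" by (intro tendsto_intros l)
    show "(\<lambda>j. B 0 - B j) \<longlonglongrightarrow> B 0 - b" by (intro tendsto_intros b)
  qed (use far[of 0] in auto)
  then show thesis using that l b by blast
qed

text \<open>From \<open>x\<close> at time \<open>n\<close> the chain moves to
  \<open>y \<in> F n x\<close> with probability \<open>w n x y\<close>; the missing mass is the
  probability of being killed. Killed mass may displace the mean by at most \<open>M\<close> per
  unit, and the remaining errors from time \<open>n\<close> on sum to
  \<open>e / 2 ^ n\<close>.\<close>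

locale killed_chain =
  fixes S :: "'a::banach set" and F :: "nat \<Rightarrow> 'a \<Rightarrow> 'a set" and w :: "nat \<Rightarrow> 'a \<Rightarrow> 'a \<Rightarrow> real"
    and M e :: real
  assumes finite_F: "x \<in> S \<Longrightarrow> finite (F n x)"
    and F_subset: "x \<in> S \<Longrightarrow> F n x \<subseteq> S"
    and w_nonneg: "x \<in> S \<Longrightarrow> y \<in> F n x \<Longrightarrow> 0 \<le> w n x y"
    and w_sum: "x \<in> S \<Longrightarrow> sum (w n x) (F n x) \<le> 1"
    and norm_le_M: "x \<in> S \<Longrightarrow> norm x \<le> M"
    and drift: "x \<in> S \<Longrightarrow> norm (x - (\<Sum>y\<in>F n x. w n x y *\<^sub>R y)) \<le>
      e / 2 ^ Suc n + M * (1 - sum (w n x) (F n x))"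
    and M_nonneg: "0 \<le> M" and e_nonneg: "0 \<le> e"
begin

text \<open>Expectation of \<open>\<phi>\<close> at time \<open>n + k\<close> for the chain started
  in \<open>x\<close> at time \<open>n\<close>, where killed paths contribute 0. The recursion
  conditions on the first step.\<close>

primrec expect :: "nat \<Rightarrow> (nat \<Rightarrow> 'a \<Rightarrow> 'b::real_vector) \<Rightarrow> nat \<Rightarrow> 'a \<Rightarrow> 'b" where
  "expect 0 \<phi> n x = \<phi> n x"
| "expect (Suc k) \<phi> n x = (\<Sum>y\<in>F n x. w n x y *\<^sub>R expect k \<phi> (Suc n) y)"

lemma F_in: "x \<in> S \<Longrightarrow> y \<in> F n x \<Longrightarrow> y \<in> S"
  using F_subset by blast

lemma weighted_mono:
  fixes \<phi> \<psi> :: "'a \<Rightarrow> real"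
  assumes "x \<in> S" "\<And>y. y \<in> S \<Longrightarrow> \<phi> y \<le> \<psi> y"
  shows "(\<Sum>y\<in>F n x. w n x y * \<phi> y) \<le> (\<Sum>y\<in>F n x. w n x y * \<psi> y)"
  using assms by (intro sum_mono mult_left_mono w_nonneg) (auto dest: F_in)

lemma weighted_le:
  assumes "x \<in> S" "\<And>y. y \<in> S \<Longrightarrow> \<phi> y \<le> c" "0 \<le> c"
  shows "(\<Sum>y\<in>F n x. w n x y * \<phi> y) \<le> c"
proof -
  have "(\<Sum>y\<in>F n x. w n x y * \<phi> y) \<le> (\<Sum>y\<in>F n x. w n x y * c)"
    by (rule weighted_mono) (use assms in auto)
  also have "\<dots> = sum (w n x) (F n x) * c" by (simp add: sum_distrib_right)
  also have "\<dots> \<le> 1 * c" using assms w_sum by (intro mult_right_mono) auto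
  finally show ?thesis by simp
qed

lemma expect_mono:
  fixes \<phi> \<psi> :: "nat \<Rightarrow> 'a \<Rightarrow> real"
  assumes "\<And>n x. x \<in> S \<Longrightarrow> \<phi> n x \<le> \<psi> n x"
  shows "x \<in> S \<Longrightarrow> expect k \<phi> n x \<le> expect k \<psi> n x"
  by (induction k arbitrary: n x) (auto intro!: weighted_mono assms)

lemma expect_invariant:
  assumes "\<And>n x. x \<in> S \<Longrightarrow> (\<Sum>y\<in>F n x. w n x y *\<^sub>R \<phi> (Suc n) y) = \<phi> n x"
  shows "x \<in> S \<Longrightarrow> expect k \<phi> n x = \<phi> n x"
proof (induction k arbitrary: n x)
  case (Suc k)
  have "expect (Suc k) \<phi> n x = (\<Sum>y\<in>F n x. w n x y *\<^sub>R \<phi> (Suc n) y)"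
    unfolding expect.simps by (rule sum.cong) (use Suc F_in in auto)
  then show ?case using assms Suc.prems by simp
qed simp

lemma expect_diff:
  "expect k (\<lambda>n x. \<phi> n x - \<psi> n x) n x = expect k \<phi> n x - expect k \<psi> n x"
  by (induction k arbitrary: n x) (simp_all add: scaleR_diff_right sum_subtractf)

lemma expect_cmult:
  fixes \<phi> :: "nat \<Rightarrow> 'a \<Rightarrow> real"
  shows "expect k (\<lambda>n x. c * \<phi> n x) n x = c * expect k \<phi> n x"
  by (induction k arbitrary: n x) (simp_all add: sum_distrib_left mult.left_commute)

text \<open>\<open>mean\<close> is not normalised: it is the integral of the position over the paths
  still alive. Hence \<open>limit_mean\<close>, divided by \<open>survival\<close>, is the
  barycenter of the chain conditioned on surviving forever.\<close>

definition "alive k n x = expect k (\<lambda>_ _. 1::real) n x"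
definition "mean k n x = expect k (\<lambda>_ y. y) n x"
definition "survival n x = lim (\<lambda>k. alive k n x)"
definition "limit_mean n x = lim (\<lambda>k. mean k n x)"

lemma alive_0: "alive 0 n x = 1"
  and alive_Suc: "alive (Suc k) n x = (\<Sum>y\<in>F n x. w n x y * alive k (Suc n) y)"
  and mean_0: "mean 0 n x = x"
  and mean_Suc: "mean (Suc k) n x = (\<Sum>y\<in>F n x. w n x y *\<^sub>R mean k (Suc n) y)"
  by (simp_all add: alive_def mean_def)

lemma alive_nonneg: "x \<in> S \<Longrightarrow> 0 \<le> alive k n x"
  by (induction k arbitrary: n x)
    (auto simp: alive_0 alive_Suc intro!: sum_nonneg mult_nonneg_nonneg w_nonneg dest: F_in)

lemma alive_Suc_le: "x \<in> S \<Longrightarrow> alive (Suc k) n x \<le> alive k n x"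
proof (induction k arbitrary: n x)
  case 0
  then show ?case using w_sum by (simp add: alive_Suc alive_0)
next
  case (Suc k)
  then show ?case unfolding alive_Suc[of "Suc k"] alive_Suc[of k n] by (intro weighted_mono) auto
qed

text \<open>For \<open>k = 0\<close> this is the drift bound. Later steps average the bound at time
  \<open>Suc n\<close>: total weight at most 1 does not enlarge the constant, and the killed mass
  averages exactly.\<close>

lemma mean_step:
  assumes "x \<in> S"
  shows "norm (mean (Suc k) n x - mean k n x) \<le>
    e / 2 ^ (n + Suc k) + M * (alive k n x - alive (Suc k) n x)"
  using assms
proof (induction k arbitrary: n x)
  case 0
  then show ?case using drift[of x n]
    by (simp add: mean_0 mean_Suc alive_0 alive_Suc norm_minus_commute algebra_simps)
next
  case (Suc k)
  let ?c = "e / 2 ^ (n + Suc (Suc k))"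
  have c: "0 \<le> ?c" using e_nonneg by simp
  have "norm (mean (Suc (Suc k)) n x - mean (Suc k) n x) =
      norm (\<Sum>y\<in>F n x. w n x y *\<^sub>R (mean (Suc k) (Suc n) y - mean k (Suc n) y))"
    unfolding mean_Suc[of "Suc k"] mean_Suc[of k n] by (simp add: sum_subtractf scaleR_diff_right)
  also have "\<dots> \<le> (\<Sum>y\<in>F n x. w n x y * (?c + M * (alive k (Suc n) y - alive (Suc k) (Suc n) y)))"
  proof (rule sum_norm_le)
    fix y assume y: "y \<in> F n x"
    have "norm (mean (Suc k) (Suc n) y - mean k (Suc n) y) \<le>
        ?c + M * (alive k (Suc n) y - alive (Suc k) (Suc n) y)"
      using Suc.IH[of y "Suc n"] F_in[OF Suc.prems y] by simp
    then show "norm (w n x y *\<^sub>R (mean (Suc k) (Suc n) y - mean k (Suc n) y)) \<le>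
        w n x y * (?c + M * (alive k (Suc n) y - alive (Suc k) (Suc n) y))"
      using w_nonneg[OF Suc.prems y] by (simp add: mult_left_mono)
  qed
  also have "\<dots> = (\<Sum>y\<in>F n x. w n x y * ?c) + M * (alive (Suc k) n x - alive (Suc (Suc k)) n x)"
    unfolding alive_Suc[of "Suc k"] alive_Suc[of k n]
    unfolding distrib_left sum.distrib right_diff_distrib sum_subtractf sum_distrib_left
    by (simp only: mult.left_commute)
  also have "(\<Sum>y\<in>F n x. w n x y * ?c) \<le> ?c" by (rule weighted_le[OF Suc.prems _ c]) simp
  finally show ?case by simp
qed

section \<open>Limits of survival probabilities and means\<close>

lemma alive_tendsto:
  assumes "x \<in> S"
  shows "(\<lambda>k. alive k n x) \<longlonglongrightarrow> survival n x"
proof -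
  have "decseq (\<lambda>k. alive k n x)" by (intro decseq_SucI alive_Suc_le assms)
  then obtain l where "(\<lambda>k. alive k n x) \<longlonglongrightarrow> l"
    using decseq_convergent[of "\<lambda>k. alive k n x" 0] alive_nonneg[OF assms] by blast
  then show ?thesis by (simp add: survival_def limI)
qed

lemma limit_mean_aux:
  assumes "x \<in> S"
  shows mean_tendsto: "(\<lambda>k. mean k n x) \<longlonglongrightarrow> limit_mean n x"
    and norm_diff_limit_mean: "norm (x - limit_mean n x) \<le> e / 2 ^ n + M * (1 - survival n x)"
proof -
  \<comment> \<open>Its decrement is exactly the bound of \<open>mean_step\<close>, since
    \<open>e / 2 ^ m\<close> drops by \<open>e / 2 ^ Suc m\<close>.\<close>
  let ?B = "\<lambda>k. e / 2 ^ (n + k) + M * alive k n x"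
  have step: "norm (mean (Suc k) n x - mean k n x) \<le> ?B k - ?B (Suc k)" for k
    using mean_step[OF assms, of k n] by (simp add: right_diff_distrib)
  have nonneg: "0 \<le> ?B k" for k
    using alive_nonneg[OF assms] e_nonneg M_nonneg by simp
  obtain l b where l: "(\<lambda>k. mean k n x) \<longlonglongrightarrow> l" and b: "?B \<longlonglongrightarrow> b"
    and le: "norm (mean 0 n x - l) \<le> ?B 0 - b"
    by (rule convergent_if_telescoping_bound[of "\<lambda>k. mean k n x" ?B, OF step nonneg])
  have lm: "limit_mean n x = l" using l by (simp add: limit_mean_def limI)
  then show "(\<lambda>k. mean k n x) \<longlonglongrightarrow> limit_mean n x" using l by simp
  have "(\<lambda>k. e / 2 ^ n * (1 / 2) ^ k + M * alive k n x) \<longlonglongrightarrow> e / 2 ^ n * 0 + M * survival n x"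
    by (intro tendsto_intros alive_tendsto assms LIMSEQ_power_zero) simp
  then have "?B \<longlonglongrightarrow> M * survival n x" by (simp add: power_add power_one_over field_simps)
  then have "b = M * survival n x" using b LIMSEQ_unique by blast
  then show "norm (x - limit_mean n x) \<le> e / 2 ^ n + M * (1 - survival n x)"
    using le lm by (simp add: mean_0 alive_0 algebra_simps)
qed

lemma survival_nonneg: "x \<in> S \<Longrightarrow> 0 \<le> survival n x"
  by (rule LIMSEQ_le_const[OF alive_tendsto]) (auto intro: alive_nonneg)

lemma survival_le_alive: "x \<in> S \<Longrightarrow> survival n x \<le> alive k n x"
  by (rule decseq_ge[OF decseq_SucI alive_tendsto]) (auto intro: alive_Suc_le)

lemma survival_le_1: "x \<in> S \<Longrightarrow> survival n x \<le> 1"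
  using survival_le_alive[of x n 0] by (simp add: alive_0)

lemma survival_invariant:
  assumes "x \<in> S"
  shows "(\<Sum>y\<in>F n x. w n x y * survival (Suc n) y) = survival n x"
proof (rule LIMSEQ_unique)
  show "(\<lambda>k. alive (Suc k) n x) \<longlonglongrightarrow> survival n x"
    using alive_tendsto[OF assms] by (rule LIMSEQ_Suc)
  show "(\<lambda>k. alive (Suc k) n x) \<longlonglongrightarrow> (\<Sum>y\<in>F n x. w n x y * survival (Suc n) y)"
    unfolding alive_Suc by (intro tendsto_intros alive_tendsto F_in[OF assms])
qed

text \<open>Individual steps preserve the mean only approximately, but in the limit the one-step
  recursion holds without error. This makes linear functionals of \<open>limit_mean\<close> exactly
  harmonic.\<close>

lemma limit_mean_invariant:
  assumes "x \<in> S"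
  shows "(\<Sum>y\<in>F n x. w n x y *\<^sub>R limit_mean (Suc n) y) = limit_mean n x"
proof (rule LIMSEQ_unique)
  show "(\<lambda>k. mean (Suc k) n x) \<longlonglongrightarrow> limit_mean n x"
    using mean_tendsto[OF assms] by (rule LIMSEQ_Suc)
  show "(\<lambda>k. mean (Suc k) n x) \<longlonglongrightarrow> (\<Sum>y\<in>F n x. w n x y *\<^sub>R limit_mean (Suc n) y)"
    unfolding mean_Suc by (intro tendsto_intros mean_tendsto F_in[OF assms])
qed

text \<open>The expectation is the mass of paths alive after \<open>k\<close> steps but killed
  later, namely \<open>alive k n x - survival n x\<close>.\<close>

lemma expect_death_tendsto_0:
  assumes "x \<in> S"
  shows "(\<lambda>k. expect k (\<lambda>n x. 1 - survival n x) n x) \<longlonglongrightarrow> 0"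
proof -
  have "expect k survival n x = survival n x" for k
    by (rule expect_invariant[OF _ assms]) (simp add: survival_invariant)
  then have "expect k (\<lambda>n x. 1 - survival n x) n x = alive k n x - survival n x" for k
    unfolding expect_diff alive_def by simp
  then show ?thesis using LIM_zero[OF alive_tendsto[OF assms]] by (simp only:)
qed

text \<open>By induction, the mean is the alive mass times a convex combination of points of
  \<open>C\<close>. The product form also covers alive mass 0.\<close>

lemma mean_in_cone:
  assumes "convex C" "S \<subseteq> C" "x \<in> S"
  shows "\<exists>c\<in>C. mean k n x = alive k n x *\<^sub>R c"
  using assms(3)
proof (induction k arbitrary: n x)
  case 0
  then show ?case using assms(2) by (auto simp: mean_0 alive_0)
next
  case (Suc k)
  have "\<forall>y\<in>F n x. \<exists>c\<in>C. mean k (Suc n) y = alive k (Suc n) y *\<^sub>R c"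
    using Suc F_in by blast
  then obtain c where c: "\<And>y. y \<in> F n x \<Longrightarrow> c y \<in> C"
    "\<And>y. y \<in> F n x \<Longrightarrow> mean k (Suc n) y = alive k (Suc n) y *\<^sub>R c y" by metis
  let ?u = "\<lambda>y. w n x y * alive k (Suc n) y" and ?a = "alive (Suc k) n x"
  have u: "0 \<le> ?u y" if "y \<in> F n x" for y
    using w_nonneg alive_nonneg F_in Suc.prems that by simp
  have mean: "mean (Suc k) n x = (\<Sum>y\<in>F n x. ?u y *\<^sub>R c y)"
    by (simp add: mean_Suc c)
  show ?case
  proof (cases "?a = 0")
    \<comment> \<open>All weights vanish, so the mean is 0 and any point of \<open>C\<close>, such
      as \<open>x\<close>, serves.\<close>
    case True
    then have "\<forall>y\<in>F n x. ?u y = 0"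
      using sum_nonneg_eq_0_iff[OF finite_F[OF Suc.prems] u] by (simp add: alive_Suc)
    then have "mean (Suc k) n x = 0" unfolding mean by (intro sum.neutral) auto
    then show ?thesis using True Suc.prems assms(2) by auto
  next
    case False
    then have a: "?a > 0" using alive_nonneg[OF Suc.prems, of "Suc k" n] by simp
    have "(\<Sum>y\<in>F n x. (?u y / ?a) *\<^sub>R c y) \<in> C"
    proof (rule convex_sum[OF finite_F[OF Suc.prems] assms(1)])
      show "(\<Sum>y\<in>F n x. ?u y / ?a) = 1"
        unfolding sum_divide_distrib[symmetric] alive_Suc[symmetric] using a by simp
    qed (use u a c in auto)
    moreover have "mean (Suc k) n x = ?a *\<^sub>R (\<Sum>y\<in>F n x. (?u y / ?a) *\<^sub>R c y)"
      using a by (simp add: mean scaleR_sum_right)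
    ultimately show ?thesis by blast
  qed
qed

lemma norm_limit_mean_le:
  assumes "x \<in> S"
  shows "norm (limit_mean n x) \<le> M * survival n x"
proof (rule LIMSEQ_le)
  show "(\<lambda>k. norm (mean k n x)) \<longlonglongrightarrow> norm (limit_mean n x)" by (intro tendsto_intros mean_tendsto assms)
  show "(\<lambda>k. M * alive k n x) \<longlonglongrightarrow> M * survival n x" by (intro tendsto_intros alive_tendsto assms)
  have "norm (mean k n x) \<le> M * alive k n x" for k
  proof -
    have "S \<subseteq> cball 0 M" using norm_le_M by auto
    then obtain c where "c \<in> cball 0 M" "mean k n x = alive k n x *\<^sub>R c"
      using mean_in_cone[OF convex_cball _ assms] by blast
    then show ?thesis using alive_nonneg[OF assms, of k n] by (simp add: mult.commute mult_right_mono)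
  qed
  then show "\<exists>N. \<forall>k\<ge>N. norm (mean k n x) \<le> M * alive k n x" by blast
qed

text \<open>The normalised means lie in \<open>C\<close> and converge to the barycenter; dividing is
  legitimate because \<open>alive\<close> stays above the positive \<open>survival\<close>.\<close>

lemma barycenter_in:
  assumes "closed C" "convex C" "S \<subseteq> C" "x \<in> S" "survival n x > 0"
  shows "limit_mean n x /\<^sub>R survival n x \<in> C"
proof (rule closed_sequentially[OF assms(1)])
  show "(\<lambda>k. mean k n x /\<^sub>R alive k n x) \<longlonglongrightarrow> limit_mean n x /\<^sub>R survival n x"
    using assms by (intro tendsto_intros mean_tendsto alive_tendsto) auto
  fix k
  have "alive k n x > 0" using survival_le_alive[OF assms(4)] assms(5) by (rule less_le_trans[rotated])
  then show "mean k n x /\<^sub>R alive k n x \<in> C" using mean_in_cone[OF assms(2-4), of k n] by auto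
qed

text \<open>The term \<open>M * \<delta>\<close> occurs twice: once for the distance from
  \<open>x\<close> to \<open>limit_mean\<close>, once for the normalisation, where
  \<open>norm_limit_mean_le\<close> cancels the factor \<open>1 / survival\<close>.\<close>

lemma barycenter_near:
  assumes "x \<in> S" "survival n x \<ge> 1 - \<delta>" "\<delta> \<le> 1 / 2"
  shows "norm (x - limit_mean n x /\<^sub>R survival n x) \<le> e + 2 * M * \<delta>"
proof -
  let ?p = "survival n x" and ?z = "limit_mean n x"
  have p: "?p > 0" "?p \<le> 1" using assms survival_le_1[of x n] by auto
  have "norm (?z - ?z /\<^sub>R ?p) = (1 / ?p - 1) * norm ?z"
  proof -
    have "?z - ?z /\<^sub>R ?p = - ((1 / ?p - 1) *\<^sub>R ?z)" by (simp add: algebra_simps divide_inverse)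
    then show ?thesis using p by simp
  qed
  also have "\<dots> \<le> (1 / ?p - 1) * (M * ?p)"
    using p norm_limit_mean_le[OF assms(1)] by (intro mult_left_mono) auto
  also have "\<dots> = M * (1 - ?p)" using p by (simp add: field_simps)
  finally have "norm (?z - ?z /\<^sub>R ?p) \<le> M * (1 - ?p)" .
  moreover have "norm (x - ?z) \<le> e / 2 ^ n + M * (1 - ?p)" by (rule norm_diff_limit_mean[OF assms(1)])
  moreover have "M * (1 - ?p) \<le> M * \<delta>" using assms M_nonneg by (intro mult_left_mono) auto
  moreover have "e / 2 ^ n \<le> e" using divide_left_mono[of 1 "2 ^ n" e] e_nonneg by simp
  moreover have "norm (x - ?z /\<^sub>R ?p) \<le> norm (x - ?z) + norm (?z - ?z /\<^sub>R ?p)"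
    using norm_triangle_ineq[of "x - ?z" "?z - ?z /\<^sub>R ?p"] by simp
  ultimately show ?thesis by simp
qed

text \<open>A function \<open>\<phi> \<le> 1\<close> that is a submartingale up to summable errors,
  with value 0 after death, bounds the alive probability from below. This yields a state with
  positive survival probability.\<close>

lemma survival_ge:
  assumes sub: "\<And>n x. x \<in> S \<Longrightarrow> \<phi> x \<le> (\<Sum>y\<in>F n x. w n x y * \<phi> y) + c / 2 ^ Suc n"
    and le1: "\<And>x. x \<in> S \<Longrightarrow> \<phi> x \<le> 1" and c: "0 \<le> c" and x: "x \<in> S"
  shows "\<phi> x - c / 2 ^ n \<le> survival n x"
proof (rule LIMSEQ_le_const[OF alive_tendsto[OF x]])
  have "\<phi> x - c / 2 ^ n \<le> alive k n x" if "x \<in> S" for k n x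
    using that
  proof (induction k arbitrary: n x)
    case 0
    have "0 \<le> c / 2 ^ n" using c by simp
    then show ?case using le1[OF 0] by (simp add: alive_0)
  next
    case (Suc k)
    let ?c = "c / 2 ^ Suc n"
    \<comment> \<open>One half of \<open>c / 2 ^ n\<close> pays for the error of this step; the
      other half is handed on to the successors.\<close>
    have "\<phi> x - c / 2 ^ n = \<phi> x - ?c - ?c" by simp
    also have "\<dots> \<le> (\<Sum>y\<in>F n x. w n x y * \<phi> y) - (\<Sum>y\<in>F n x. w n x y * ?c)"
      using sub[OF Suc.prems, of n] weighted_le[OF Suc.prems, of "\<lambda>_. ?c" ?c n] c by simp
    also have "\<dots> = (\<Sum>y\<in>F n x. w n x y * (\<phi> y - ?c))"
      by (simp only: sum_subtractf right_diff_distrib)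
    also have "\<dots> \<le> alive (Suc k) n x"
      unfolding alive_Suc by (rule weighted_mono[OF Suc.prems Suc.IH])
    finally show ?case .
  qed
  then show "\<exists>N. \<forall>k\<ge>N. \<phi> x - c / 2 ^ n \<le> alive k n x" using x by blast
qed

text \<open>Otherwise \<open>q\<close> would be dominated by a multiple of the death probability
  \<open>1 - survival\<close>, whose expectation after \<open>k\<close> steps tends to \<open>0\<close>, while that of \<open>q\<close> stays
  constant.\<close>

lemma surviving_transition_ex:
  assumes inv: "\<And>n x. x \<in> S \<Longrightarrow> (\<Sum>y\<in>F n x. w n x y * q (Suc n) y) = q n x"
    and le: "\<And>n x. x \<in> S \<Longrightarrow> q n x \<le> c" and c: "0 \<le> c"
    and pos: "x\<^sub>0 \<in> S" "q n\<^sub>0 x\<^sub>0 > 0" and \<delta>: "\<delta> > 0"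
  shows "\<exists>n x. \<exists>y\<in>F n x. x \<in> S \<and> q n x > 0 \<and> q (Suc n) y > 0 \<and>
    survival n x > 1 - \<delta> \<and> survival (Suc n) y > 1 - \<delta>"
proof (rule ccontr)
  assume contra: "\<not> ?thesis"
  then have none: "q (Suc n) y \<le> 0 \<or> survival (Suc n) y \<le> 1 - \<delta>"
    if "x \<in> S" "y \<in> F n x" "q n x > 0" "survival n x > 1 - \<delta>" for n x y
    using that contra by (meson not_le)
  let ?r = "\<lambda>n x. 1 - survival n x"
  have r: "0 \<le> ?r n x" if "x \<in> S" for n x using survival_le_1[OF that] by simp
  have bad: "q n x \<le> c / \<delta> * ?r n x" if "x \<in> S" "q n x \<le> 0 \<or> survival n x \<le> 1 - \<delta>" for n x
    using that(2)
  proof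
    assume "q n x \<le> 0"
    then show ?thesis using r[OF that(1), of n] c \<delta> by (simp add: order_trans[of _ 0])
  next
    assume "survival n x \<le> 1 - \<delta>"
    then have "c / \<delta> * \<delta> \<le> c / \<delta> * ?r n x" using c \<delta> by (intro mult_left_mono) auto
    then show ?thesis using le[OF that(1), of n] \<delta> by simp
  qed
  \<comment> \<open>If \<open>(n, x)\<close> is not covered by \<open>bad\<close>, then by
    \<open>none\<close> all its successors are, and their bounds are averaged. Harmonicity of
    \<open>survival\<close> turns the average back into a bound at \<open>(n, x)\<close>.\<close>
  have dom: "q n x \<le> c / \<delta> * ?r n x" if x: "x \<in> S" for n x
  proof (cases "q n x \<le> 0 \<or> survival n x \<le> 1 - \<delta>")
    case False
    have "q n x = (\<Sum>y\<in>F n x. w n x y * q (Suc n) y)" by (rule inv[OF x, symmetric])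
    also have "\<dots> \<le> (\<Sum>y\<in>F n x. w n x y * (c / \<delta> * ?r (Suc n) y))"
      using False none x by (intro sum_mono mult_left_mono w_nonneg bad) (auto dest: F_in simp: not_le)
    also have "\<dots> = c / \<delta> * (sum (w n x) (F n x) - (\<Sum>y\<in>F n x. w n x y * survival (Suc n) y))"
      by (simp add: sum_distrib_left sum_subtractf algebra_simps)
    also have "\<dots> = c / \<delta> * (sum (w n x) (F n x) - survival n x)"
      by (simp only: survival_invariant[OF x])
    also have "\<dots> \<le> c / \<delta> * ?r n x" using w_sum[OF x] c \<delta> by (intro mult_left_mono) auto
    finally show ?thesis .
  qed (rule bad[OF x])
  have "q n\<^sub>0 x\<^sub>0 \<le> c / \<delta> * expect k ?r n\<^sub>0 x\<^sub>0" for k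
  proof -
    have "q n\<^sub>0 x\<^sub>0 = expect k q n\<^sub>0 x\<^sub>0"
      using inv pos(1) by (intro expect_invariant[symmetric]) auto
    also have "\<dots> \<le> expect k (\<lambda>n x. c / \<delta> * ?r n x) n\<^sub>0 x\<^sub>0"
      by (rule expect_mono[OF dom pos(1)])
    finally show ?thesis by (simp only: expect_cmult)
  qed
  moreover have "(\<lambda>k. c / \<delta> * expect k ?r n\<^sub>0 x\<^sub>0) \<longlonglongrightarrow> c / \<delta> * 0"
    by (intro tendsto_intros expect_death_tendsto_0 pos)
  ultimately have "q n\<^sub>0 x\<^sub>0 \<le> c / \<delta> * 0" by (intro LIMSEQ_le_const) blast+
  then show False using pos by simp
qed

end

subsection \<open>Small slices\<close>

text \<open>This constructs one step of the chain: in a convex combination near \<open>x\<close>,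
  points of \<open>T\<close> become successors and the others are killed. Killed points satisfy
  \<open>f y - a \<le> 0\<close>, so dropping them does not lower the average of
  \<open>f - a\<close>.\<close>

lemma closure_convex_hull_Un_approx:
  fixes x :: "'a::real_normed_vector" and f :: "'a \<Rightarrow>\<^sub>L real"
  assumes x: "x \<in> closure (convex hull (N \<union> T))" and e: "e > 0"
    and N: "\<And>y. y \<in> N \<Longrightarrow> norm y \<le> M \<and> blinfun_apply f y \<le> a"
  shows "\<exists>F w. finite F \<and> F \<subseteq> T \<and> (\<forall>y\<in>F. 0 \<le> w y) \<and> sum w F \<le> 1 \<and>
    norm (x - (\<Sum>y\<in>F. w y *\<^sub>R y)) \<le> e + M * (1 - sum w F) \<and>
    f x - a \<le> (\<Sum>y\<in>F. w y * (f y - a)) + norm f * e"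
proof -
  obtain v where v: "v \<in> convex hull (N \<union> T)" "norm (x - v) < e"
    using x e by (auto simp: closure_approachable dist_norm norm_minus_commute)
  then obtain V w where V: "finite V" "V \<subseteq> N \<union> T" "\<And>y. y \<in> V \<Longrightarrow> 0 \<le> w y" "sum w V = 1"
    and v_eq: "(\<Sum>y\<in>V. w y *\<^sub>R y) = v"
    by (auto simp: convex_hull_explicit)
  define F where "F = V \<inter> T"
  define R where "R = V - F"
  have split: "sum h V = sum h F + sum h R" for h :: "'a \<Rightarrow> 'b::comm_monoid_add"
    unfolding F_def R_def using V(1) by (metis inf_le1 sum.subset_diff add.commute)
  have R: "y \<in> N" "0 \<le> w y" if "y \<in> R" for y using that V by (auto simp: R_def F_def)
  have wF: "\<And>y. y \<in> F \<Longrightarrow> 0 \<le> w y" using V by (auto simp: F_def)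
  have wR: "sum w R = 1 - sum w F" using split[of w] V by simp
  have wR0: "0 \<le> sum w R" using R by (simp add: sum_nonneg)
  have "norm (x - (\<Sum>y\<in>F. w y *\<^sub>R y)) \<le> norm (x - v) + norm (\<Sum>y\<in>R. w y *\<^sub>R y)"
    using norm_triangle_ineq[of "x - v" "\<Sum>y\<in>R. w y *\<^sub>R y"] split[of "\<lambda>y. w y *\<^sub>R y"] v_eq
    by (simp add: algebra_simps)
  also have "norm (\<Sum>y\<in>R. w y *\<^sub>R y) \<le> (\<Sum>y\<in>R. w y * M)"
    using R N by (intro sum_norm_le) (simp add: mult_left_mono)
  also have "\<dots> = M * (1 - sum w F)" by (simp flip: wR sum_distrib_right)
  finally have 1: "norm (x - (\<Sum>y\<in>F. w y *\<^sub>R y)) \<le> e + M * (1 - sum w F)" using v(2) by simp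
  have "f x - f v \<le> norm (f (x - v))" by (simp add: blinfun.diff_right)
  also have "\<dots> \<le> norm f * norm (x - v)" by (rule norm_blinfun)
  also have "\<dots> \<le> norm f * e" using v(2) by (intro mult_left_mono) auto
  finally have fx: "f x - f v \<le> norm f * e" .
  have "f v - a = (\<Sum>y\<in>V. w y * f y) - (\<Sum>y\<in>V. w y * a)"
    using V(4) by (simp add: blinfun.sum_right blinfun.scaleR_right flip: v_eq sum_distrib_right)
  also have "\<dots> = (\<Sum>y\<in>F. w y * (f y - a)) + (\<Sum>y\<in>R. w y * (f y - a))"
    unfolding split right_diff_distrib sum_subtractf by simp
  also have "(\<Sum>y\<in>R. w y * (f y - a)) \<le> 0"
    using R N by (intro sum_nonpos mult_nonneg_nonpos) auto
  finally have 2: "f x - a \<le> (\<Sum>y\<in>F. w y * (f y - a)) + norm f * e" using fx by simp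
  show ?thesis
    by (rule exI[of _ F], rule exI[of _ w])
      (use V(1) wF wR wR0 1 2 in \<open>simp add: F_def\<close>)
qed

lemma ediam_lessD:
  assumes "ediam d S < ennreal \<epsilon>" "x \<in> S" "y \<in> S" "0 \<le> d x y"
  shows "d x y < \<epsilon>"
proof -
  have "ennreal (d x y) \<le> ediam d S"
    unfolding ediam_def using assms by (meson SUP_upper2 order_refl)
  then show ?thesis using assms by (metis ennreal_less_iff order.strict_trans1)
qed

lemma ediam_le:
  assumes "\<And>x y. x \<in> S \<Longrightarrow> y \<in> S \<Longrightarrow> d x y \<le> \<epsilon>"
  shows "ediam d S \<le> ennreal \<epsilon>"
  unfolding ediam_def using assms by (intro SUP_least ennreal_leI)

text \<open>The induction step for nested slices. Dentability is applied not to \<open>K\<close> but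
  to the set of barycenters of a chain living on the given slice.\<close>

lemma small_slice_inside_slice:
  fixes f :: "'a::banach \<Rightarrow>\<^sub>L real"
  assumes metric: "Metric_space C d"
    and dent: "dentable C d" and uc: "uniformly_continuous_on_bounded_sets C d"
    and K: "K \<subseteq> C" "closed K" "convex K" "bounded K"
    and x0: "x\<^sub>0 \<in> K" "f x\<^sub>0 > a" and \<eta>: "\<eta> > 0"
  shows "\<exists>(g :: 'a \<Rightarrow>\<^sub>L real) b. (\<exists>x\<in>K. g x > b) \<and> (\<forall>x\<in>K. g x > b \<longrightarrow> f x > a) \<and>
    (\<forall>x\<in>K. \<forall>y\<in>K. g x > b \<longrightarrow> g y > b \<longrightarrow> d x y < \<eta>)"
proof (rule ccontr)
  interpret Metric_space C d by (rule metric)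
  assume contra: "\<not> ?thesis"
  define S where "S = {x\<in>K. f x > a}"
  have SK: "S \<subseteq> K" by (auto simp: S_def)
  \<comment> \<open>Otherwise a separating half-space cuts from \<open>K\<close> a slice inside
    \<open>S\<close> and inside the \<open>d\<close>-ball of radius \<open>\<eta> / 2\<close> around
    \<open>x\<close>, hence one of the slices excluded by \<open>contra\<close>.\<close>
  have far: "x \<in> closure (convex hull ((K - S) \<union> {y\<in>S. d x y \<ge> \<eta> / 2}))" if x: "x \<in> S" for x
  proof (rule ccontr)
    let ?D = "closure (convex hull ((K - S) \<union> {y\<in>S. d x y \<ge> \<eta> / 2}))"
    assume "x \<notin> ?D"
    then obtain g :: "'a \<Rightarrow>\<^sub>L real" and b where g: "g x > b" and le: "\<And>y. y \<in> ?D \<Longrightarrow> g y \<le> b"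
      by (rule hahn_banach_separation[OF closed_closure convex_closure[OF convex_convex_hull]]) blast
    have D: "(K - S) \<union> {y\<in>S. d x y \<ge> \<eta> / 2} \<subseteq> ?D"
      by (meson closure_subset hull_subset subset_trans)
    have near: "y \<in> S \<and> d x y < \<eta> / 2" if "y \<in> K" "g y > b" for y
      using that D le[of y] by force
    have "d y z < \<eta>" if "y \<in> K" "z \<in> K" "g y > b" "g z > b" for y z
    proof -
      have "d x y < \<eta> / 2" "d x z < \<eta> / 2" using near that by auto
      moreover have "x \<in> C" "y \<in> C" "z \<in> C" using that x SK K(1) by auto
      ultimately show ?thesis using triangle[of y x z] commute[of x y] by simp
    qed
    then have "(\<exists>x\<in>K. g x > b) \<and> (\<forall>x\<in>K. g x > b \<longrightarrow> f x > a) \<and>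
        (\<forall>x\<in>K. \<forall>y\<in>K. g x > b \<longrightarrow> g y > b \<longrightarrow> d x y < \<eta>)"
      using g x SK near by (auto simp: S_def)
    then show False using contra by blast
  qed
  obtain R where R: "R > 0" "\<And>x. x \<in> K \<Longrightarrow> norm x \<le> R"
    using K(4) by (auto simp: bounded_pos)
  have "\<eta> / 8 > 0" using \<eta> by simp
  then obtain \<delta>\<^sub>0 where \<delta>\<^sub>0: "\<delta>\<^sub>0 > 0" "\<And>x y. x \<in> K \<Longrightarrow> y \<in> K \<Longrightarrow> norm (x - y) < \<delta>\<^sub>0 \<Longrightarrow> d x y < \<eta> / 8"
    using uc K unfolding uniformly_continuous_on_bounded_sets_def by meson
  \<comment> \<open>The first bound, with that on \<open>\<delta>\<close>, keeps barycenters within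
    \<open>\<delta>\<^sub>0\<close> of states whose survival probability exceeds
    \<open>1 - \<delta>\<close>. The second gives \<open>norm f * e < f x\<^sub>0 - a\<close>, so
    that the chain from \<open>x\<^sub>0\<close> survives with positive probability.\<close>
  define e where "e = min (\<delta>\<^sub>0 / 4) ((f x\<^sub>0 - a) / (2 * (norm f + 1)))"
  define \<delta> where "\<delta> = min (1 / 2) (\<delta>\<^sub>0 / (8 * R))"
  have nf: "norm f + 1 > 0" by (rule add_nonneg_pos) auto
  have e: "e > 0" "e \<le> \<delta>\<^sub>0 / 4"
    unfolding e_def using \<delta>\<^sub>0(1) x0(2) nf by (simp, intro min.cobounded1)
  have \<delta>: "\<delta> > 0" "\<delta> \<le> 1 / 2" "\<delta> \<le> \<delta>\<^sub>0 / (8 * R)"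
    unfolding \<delta>_def using \<delta>\<^sub>0(1) R(1) by (simp, intro min.cobounded1, intro min.cobounded2)
  have small: "e + 2 * R * \<delta> < \<delta>\<^sub>0"
  proof -
    have "2 * R * \<delta> \<le> 2 * R * (\<delta>\<^sub>0 / (8 * R))" using \<delta> R by (intro mult_left_mono) auto
    also have "\<dots> = \<delta>\<^sub>0 / 4" using R by simp
    finally show ?thesis using e \<delta>\<^sub>0 by simp
  qed
  have fe: "norm f * e < f x\<^sub>0 - a"
  proof -
    have "norm f * e \<le> (norm f + 1) * ((f x\<^sub>0 - a) / (2 * (norm f + 1)))"
      using e(1) x0(2) unfolding e_def by (intro mult_mono min.cobounded2) auto
    also have "\<dots> = (f x\<^sub>0 - a) / 2" using nf by (simp add: field_simps)
    finally show ?thesis using x0 by simp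
  qed
  \<comment> \<open>Admissible transitions from \<open>x\<close> at time \<open>n\<close>:
    \<open>d\<close>-large moves inside \<open>S\<close>, the axioms of a killed chain, and the
    submartingale property of \<open>f - a\<close> up to an error.\<close>
  define P where "P = (\<lambda>n x F w. finite F \<and> F \<subseteq> {y\<in>S. d x y \<ge> \<eta> / 2} \<and> (\<forall>y\<in>F. 0 \<le> w y) \<and>
    sum w F \<le> 1 \<and> norm (x - (\<Sum>y\<in>F. w y *\<^sub>R y)) \<le> e / 2 ^ Suc n + R * (1 - sum w F) \<and>
    f x - a \<le> (\<Sum>y\<in>F. w y * (f y - a)) + norm f * (e / 2 ^ Suc n))"
  have "\<exists>F w. P n x F w" if x: "x \<in> S" for n x
  proof -
    have "e / 2 ^ Suc n > 0" using e by simp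
    moreover have "norm y \<le> R \<and> f y \<le> a" if "y \<in> K - S" for y using that R by (auto simp: S_def)
    ultimately show ?thesis
      unfolding P_def by (rule closure_convex_hull_Un_approx[OF far[OF x]])
  qed
  then have "\<forall>n x. \<exists>h. x \<in> S \<longrightarrow> P n x (fst h) (snd h)" by (metis fst_conv snd_conv)
  then obtain h where h: "\<And>n x. x \<in> S \<Longrightarrow> P n x (fst (h n x)) (snd (h n x))"
    unfolding choice_iff by blast
  define F where "F = (\<lambda>n x. fst (h n x))"
  define w where "w = (\<lambda>n x. snd (h n x))"
  have Fw: "P n x (F n x) (w n x)" if "x \<in> S" for n x
    unfolding F_def w_def using h[OF that] .
  interpret chain: killed_chain S F w R e
  proof
    fix n x assume x: "x \<in> S"
    note * = Fw[OF x, of n, unfolded P_def]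
    show "finite (F n x)" "F n x \<subseteq> S" "sum (w n x) (F n x) \<le> 1"
      "norm (x - (\<Sum>y\<in>F n x. w n x y *\<^sub>R y)) \<le> e / 2 ^ Suc n + R * (1 - sum (w n x) (F n x))"
      using * by blast+
    show "0 \<le> w n x y" if "y \<in> F n x" for y using * that by blast
    show "norm x \<le> R" using x SK R by blast
  qed (use R e in auto)
  define \<beta> where "\<beta> = (\<lambda>n x. chain.limit_mean n x /\<^sub>R chain.survival n x)"
  \<comment> \<open>Starting states and times both vary, so that the barycenters of successors
    belong to \<open>A\<close> again.\<close>
  define A where "A = {\<beta> n x | n x. x \<in> S \<and> chain.survival n x > 0}"
  have \<beta>K: "\<beta> n x \<in> K" if "x \<in> S" "chain.survival n x > 0" for n x
    unfolding \<beta>_def using chain.barycenter_in[OF K(2,3) SK that] .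
  have \<beta>_near: "d x (\<beta> n x) < \<eta> / 8" if "x \<in> S" "chain.survival n x > 1 - \<delta>" for n x
  proof (rule \<delta>\<^sub>0(2))
    show "x \<in> K" using that SK by blast
    show "\<beta> n x \<in> K" using that \<delta> by (intro \<beta>K) auto
    show "norm (x - \<beta> n x) < \<delta>\<^sub>0"
      unfolding \<beta>_def using chain.barycenter_near[OF that(1), of \<delta> n] that \<delta> small by simp
  qed
  have x0S: "x\<^sub>0 \<in> S" using x0 by (simp add: S_def)
  have surv: "chain.survival 0 x\<^sub>0 > 0"
  proof -
    \<comment> \<open>\<open>L\<close> is positive and bounds \<open>f - a\<close> on
      \<open>S\<close>, so \<open>(f - a) / L\<close> is a valid \<open>\<phi>\<close> in
      \<open>survival_ge\<close>, used at time 0.\<close>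
    define L where "L = norm f * R + \<bar>a\<bar> + 1"
    have L: "L > 0" unfolding L_def using R by (intro add_nonneg_pos) auto
    have "(f x\<^sub>0 - a) / L - (norm f * e / L) / 2 ^ 0 \<le> chain.survival 0 x\<^sub>0"
    proof (rule chain.survival_ge[OF _ _ _ x0S])
      fix n x assume "x \<in> S"
      then have "f x - a \<le> (\<Sum>y\<in>F n x. w n x y * (f y - a)) + norm f * (e / 2 ^ Suc n)"
        using Fw by (auto simp: P_def)
      then have "(f x - a) / L \<le> ((\<Sum>y\<in>F n x. w n x y * (f y - a)) + norm f * (e / 2 ^ Suc n)) / L"
        using L by (intro divide_right_mono) auto
      then show "(f x - a) / L \<le>
          (\<Sum>y\<in>F n x. w n x y * ((f y - a) / L)) + norm f * e / L / 2 ^ Suc n"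
        by (simp add: add_divide_distrib sum_divide_distrib mult.commute[of L])
    next
      fix x assume "x \<in> S"
      then have "norm (f x) \<le> norm f * R"
        using norm_blinfun[of f x] R(2)[of x] SK by (meson mult_left_mono norm_ge_zero order_trans subsetD)
      then have "f x - a \<le> L" by (simp add: L_def)
      then show "(f x - a) / L \<le> 1" using L by simp
    qed (use e L in auto)
    moreover have "(f x\<^sub>0 - a) / L - norm f * e / L > 0"
      using fe L by (simp add: divide_strict_right_mono)
    ultimately show ?thesis by simp
  qed
  have AK: "A \<subseteq> K" using \<beta>K by (auto simp: A_def)
  have "A \<subseteq> C" "bounded A" using AK K bounded_subset by auto
  moreover have "A \<noteq> {}" using surv x0S by (auto simp: A_def)
  ultimately obtain H where H: "open_halfspace H" "A \<inter> H \<noteq> {}" "ediam d (A \<inter> H) < ennreal (\<eta> / 8)"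
    using dent \<open>\<eta> / 8 > 0\<close> unfolding dentable_def by blast
  obtain g :: "'a \<Rightarrow>\<^sub>L real" and b where Hg: "H = {x. g x > b}"
    using H(1) by (auto simp: open_halfspace_def)
  \<comment> \<open>Where survival is positive, \<open>q\<close> has the sign of
    \<open>g (\<beta> n x) - b\<close>. The factor \<open>survival\<close> makes it linear in two
    harmonic quantities, hence harmonic itself.\<close>
  define q where "q = (\<lambda>n x. g (chain.limit_mean n x) - b * chain.survival n x)"
  have q_pos: "\<beta> n x \<in> H \<longleftrightarrow> q n x > 0" if "chain.survival n x > 0" for n x
    using that by (simp add: Hg q_def \<beta>_def blinfun.scaleR_right field_simps)
  obtain n1 x1 where x1: "x1 \<in> S" "q n1 x1 > 0"
    using H(2) q_pos by (auto simp: A_def)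
  have "\<exists>n x. \<exists>y\<in>F n x. x \<in> S \<and> q n x > 0 \<and> q (Suc n) y > 0 \<and>
    chain.survival n x > 1 - \<delta> \<and> chain.survival (Suc n) y > 1 - \<delta>"
  proof (rule chain.surviving_transition_ex[of q, OF _ _ _ x1 \<delta>(1)])
    fix n x assume x: "x \<in> S"
    have "(\<Sum>y\<in>F n x. w n x y * q (Suc n) y) =
        g (\<Sum>y\<in>F n x. w n x y *\<^sub>R chain.limit_mean (Suc n) y)
        - b * (\<Sum>y\<in>F n x. w n x y * chain.survival (Suc n) y)"
      by (simp add: q_def blinfun.sum_right blinfun.scaleR_right sum_distrib_left
          right_diff_distrib sum_subtractf mult.left_commute)
    then show "(\<Sum>y\<in>F n x. w n x y * q (Suc n) y) = q n x"
      by (simp only: chain.limit_mean_invariant[OF x] chain.survival_invariant[OF x] q_def)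
  next
    fix n x assume x: "x \<in> S"
    let ?p = "chain.survival n x" and ?z = "chain.limit_mean n x"
    have p: "0 \<le> ?p" "?p \<le> 1" using chain.survival_nonneg[OF x] chain.survival_le_1[OF x] by auto
    have "norm ?z \<le> R"
      by (rule order_trans[OF chain.norm_limit_mean_le[OF x] mult_left_le[OF p(2) less_imp_le[OF R(1)]]])
    then have "norm (g ?z) \<le> norm g * R"
      using norm_blinfun[of g ?z] by (meson mult_left_mono norm_ge_zero order_trans)
    moreover have "\<bar>b * ?p\<bar> \<le> \<bar>b\<bar>" using p by (simp add: abs_mult mult_left_le)
    ultimately show "q n x \<le> norm g * R + \<bar>b\<bar>" by (simp add: q_def)
  qed (use R in auto)
  then obtain n x y where xy: "x \<in> S" "y \<in> F n x" "q n x > 0" "q (Suc n) y > 0"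
    "chain.survival n x > 1 - \<delta>" "chain.survival (Suc n) y > 1 - \<delta>" by blast
  have y: "y \<in> S" "d x y \<ge> \<eta> / 2" using Fw[OF xy(1)] xy(2) by (auto simp: P_def)
  let ?x = "\<beta> n x" and ?y = "\<beta> (Suc n) y"
  have p: "chain.survival n x > 0" "chain.survival (Suc n) y > 0" using xy \<delta> by auto
  have "?x \<in> A \<inter> H" "?y \<in> A \<inter> H" using xy p q_pos y by (auto simp: A_def)
  then have "d ?x ?y < \<eta> / 8" using ediam_lessD[OF H(3)] by simp
  moreover have "d x ?x < \<eta> / 8" "d y ?y < \<eta> / 8" using xy y \<beta>_near by auto
  moreover have "x \<in> C" "y \<in> C" "?x \<in> C" "?y \<in> C" using xy y p \<beta>K SK K(1) by blast+
  \<comment> \<open>Three distances below \<open>\<eta> / 8\<close>, through the two barycenters,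
    contradict the step size of at least \<open>\<eta> / 2\<close>.\<close>
  ultimately have "d x y < \<eta> / 2"
    using triangle[of x ?x y] triangle[of ?x ?y y] commute[of ?y y] \<eta> by simp
  then show False using y by simp
qed

section \<open>Nested slices shrinking to a point\<close>

theorem theorem1p5:
  fixes C :: "'a::banach set" and d :: "'a \<Rightarrow> 'a \<Rightarrow> real"
  assumes "closed C" and "convex C"
    and "Metric_space C d"
    and "Metric_space.mcomplete C d"
    and "dentable C d"
    and "uniformly_continuous_on_bounded_sets C d"
    and "Metric_space.mtopology C d = top_of_set C"
  shows "radon_nikodym_property C"
  unfolding radon_nikodym_property_def dentable_def
proof (intro allI impI)
  interpret Metric_space C d by fact
  fix A and \<epsilon> :: real
  assume A: "A \<subseteq> C \<and> A \<noteq> {} \<and> bounded A \<and> 0 < \<epsilon>"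
  define K where "K = closure (convex hull A)"
  have AK: "A \<subseteq> K" unfolding K_def by (meson closure_subset hull_subset subset_trans)
  have K: "K \<subseteq> C" "closed K" "convex K" "bounded K"
    using A assms(1,2)
    by (simp_all add: K_def convex_closure bounded_convex_hull bounded_closure
        hull_minimal closure_minimal)
  note small = small_slice_inside_slice[OF assms(3,5,6) K]
  define slice where "slice = (\<lambda>(g :: 'a \<Rightarrow>\<^sub>L real, b). {x\<in>K. g x > b})"
  have "\<exists>s. \<forall>n. (slice (s n) \<noteq> {} \<and> (\<forall>x\<in>slice (s n). \<forall>y\<in>slice (s n). d x y < (1 / 2) ^ n)) \<and>
      slice (s (Suc n)) \<subseteq> slice (s n)"
  proof (rule dependent_nat_choice)
    obtain x where x: "x \<in> K" using A AK by blast
    \<comment> \<open>The zero functional with threshold \<open>- 1\<close> makes all of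
      \<open>K\<close> the initial slice.\<close>
    have "(0 :: 'a \<Rightarrow>\<^sub>L real) x > - 1" by simp
    from small[OF x this zero_less_one] obtain g :: "'a \<Rightarrow>\<^sub>L real" and b where "\<exists>x\<in>K. blinfun_apply g x > b"
      "\<forall>x\<in>K. \<forall>y\<in>K. g x > b \<longrightarrow> g y > b \<longrightarrow> d x y < 1"
      by blast
    then have "slice (g, b) \<noteq> {} \<and> (\<forall>x\<in>slice (g, b). \<forall>y\<in>slice (g, b). d x y < (1 / 2) ^ 0)"
      by (auto simp: slice_def)
    then show "\<exists>s. slice s \<noteq> {} \<and> (\<forall>x\<in>slice s. \<forall>y\<in>slice s. d x y < (1 / 2) ^ 0)" ..
  next
    fix s n assume "slice s \<noteq> {} \<and> (\<forall>x\<in>slice s. \<forall>y\<in>slice s. d x y < (1 / 2) ^ n)"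
    moreover obtain f a where s: "s = (f, a)" by fastforce
    ultimately obtain x where x: "x \<in> K" "blinfun_apply f x > a" by (auto simp: slice_def)
    have "(1 / 2 :: real) ^ Suc n > 0" by simp
    from small[OF x this] obtain g :: "'a \<Rightarrow>\<^sub>L real" and b where "\<exists>x\<in>K. blinfun_apply g x > b"
      "\<forall>x\<in>K. g x > b \<longrightarrow> f x > a"
      "\<forall>x\<in>K. \<forall>y\<in>K. g x > b \<longrightarrow> g y > b \<longrightarrow> d x y < (1 / 2) ^ Suc n" by blast
    then have "(slice (g, b) \<noteq> {} \<and>
        (\<forall>x\<in>slice (g, b). \<forall>y\<in>slice (g, b). d x y < (1 / 2) ^ Suc n)) \<and> slice (g, b) \<subseteq> slice s"
      unfolding slice_def s by blast
    then show "\<exists>t. (slice t \<noteq> {} \<and> (\<forall>x\<in>slice t. \<forall>y\<in>slice t. d x y < (1 / 2) ^ Suc n)) \<and>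
        slice t \<subseteq> slice s" ..
  qed
  then obtain s where ne: "\<And>n. slice (s n) \<noteq> {}"
    and diam: "\<And>n x y. x \<in> slice (s n) \<Longrightarrow> y \<in> slice (s n) \<Longrightarrow> d x y < (1 / 2) ^ n"
    and Suc: "\<And>n. slice (s (Suc n)) \<subseteq> slice (s n)" by blast
  have dec: "slice (s n) \<subseteq> slice (s m)" if "m \<le> n" for m n
    using lift_Suc_antimono_le[of "\<lambda>n. slice (s n)"] Suc that by blast
  define \<sigma> where "\<sigma> = (\<lambda>n. SOME x. x \<in> slice (s n))"
  have \<sigma>: "\<sigma> n \<in> slice (s n)" for n unfolding \<sigma>_def using ne by (simp add: some_in_eq)
  have sC: "slice t \<subseteq> C" for t using K(1) by (cases t) (auto simp: slice_def)
  have pow: "\<exists>n. (1 / 2 :: real) ^ n < r" if "r > 0" for r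
    using real_arch_pow_inv[OF that] by simp
  have "MCauchy \<sigma>"
    unfolding MCauchy_def
  proof (intro conjI allI impI)
    show "range \<sigma> \<subseteq> C" using \<sigma> sC by blast
    fix r :: real assume "r > 0"
    then obtain N where N: "(1 / 2 :: real) ^ N < r" using pow by blast
    show "\<exists>N. \<forall>n n'. N \<le> n \<longrightarrow> N \<le> n' \<longrightarrow> d (\<sigma> n) (\<sigma> n') < r"
      using dec \<sigma> diam N by (meson order_less_trans subsetD)
  qed
  then obtain x where "limitin mtopology \<sigma> x sequentially"
    using assms(4) unfolding mcomplete_def by blast
  then have x: "x \<in> C" and lim: "\<And>r. r > 0 \<Longrightarrow> \<exists>N. \<forall>n\<ge>N. d (\<sigma> n) x < r"
    unfolding limit_metric_sequentially by blast+
  \<comment> \<open>The limit \<open>x\<close> need not lie in the slices. It is compared with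
    \<open>y\<close> through a late \<open>\<sigma> m\<close> in the same slice, each leg costing at
    most \<open>(1 / 2) ^ n\<close>.\<close>
  have near: "d x y < 2 * (1 / 2) ^ n" if y: "y \<in> slice (s n)" for y n
  proof -
    obtain m where m: "n \<le> m" "d (\<sigma> m) x < (1 / 2) ^ n"
      using lim[of "(1 / 2) ^ n"] by (metis linorder_linear zero_less_power half_gt_zero zero_less_one)
    have "\<sigma> m \<in> slice (s n)" using dec[OF m(1)] \<sigma> by blast
    then show ?thesis
      using diam[of "\<sigma> m" n y] y m triangle[of x "\<sigma> m" y] commute[of x "\<sigma> m"] x sC by fastforce
  qed
  \<comment> \<open>Since both topologies on \<open>C\<close> agree, the norm ball around
    \<open>x\<close> contains a \<open>d\<close>-ball, and so a whole slice.\<close>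
  have "openin mtopology (C \<inter> ball x (\<epsilon> / 3))"
    unfolding assms(7) by (simp add: openin_open_Int)
  then obtain r where r: "r > 0" "mball x r \<subseteq> C \<inter> ball x (\<epsilon> / 3)"
    using x A unfolding openin_mtopology by force
  obtain n where "(1 / 2 :: real) ^ n < r / 2" using pow[of "r / 2"] r by auto
  then have n: "2 * (1 / 2) ^ n < r" by simp
  have ball: "dist x y < \<epsilon> / 3" if y: "y \<in> slice (s n)" for y
  proof -
    have "y \<in> mball x r" using near[OF y] n x subsetD[OF sC y] by simp
    then show ?thesis using r(2) by auto
  qed
  obtain g b where gb: "s n = (g, b)" by fastforce
  define H where "H = {x. blinfun_apply g x > b}"
  \<comment> \<open>If \<open>A\<close> missed \<open>H\<close>, the closed convex set
    \<open>{x. g x \<le> b}\<close> would contain \<open>A\<close>, hence \<open>K\<close>, and the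
    slice would be empty.\<close>
  have "A \<inter> H \<noteq> {}"
  proof
    assume "A \<inter> H = {}"
    then have "A \<subseteq> {x. g x \<le> b}" by (auto simp: H_def not_less)
    moreover have "convex {x. g x \<le> b}"
      by (rule convexI) (auto simp: blinfun.add_right blinfun.scaleR_right intro: convex_bound_le)
    moreover have "closed {x. g x \<le> b}"
      by (intro closed_Collect_le continuous_intros)
    ultimately have "K \<subseteq> {x. g x \<le> b}" unfolding K_def by (simp add: closure_minimal hull_minimal)
    then show False using ne[of n] by (auto simp: slice_def gb)
  qed
  \<comment> \<open>Radius \<open>\<epsilon> / 3\<close> leaves room for a strict inequality after
    taking the supremum.\<close>
  moreover have "ediam (\<lambda>x y. norm (x - y)) (A \<inter> H) \<le> ennreal (2 * \<epsilon> / 3)"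
  proof (rule ediam_le)
    fix y z assume "y \<in> A \<inter> H" "z \<in> A \<inter> H"
    then have "y \<in> slice (s n)" "z \<in> slice (s n)" using AK by (auto simp: slice_def gb H_def)
    then show "norm (y - z) \<le> 2 * \<epsilon> / 3"
      using ball[of y] ball[of z] dist_triangle3[of y z x] by (simp add: dist_norm)
  qed
  moreover have "ennreal (2 * \<epsilon> / 3) < ennreal \<epsilon>" using A by (simp add: ennreal_lessI)
  moreover have "open_halfspace H" unfolding open_halfspace_def H_def by blast
  ultimately show "\<exists>H. open_halfspace H \<and> A \<inter> H \<noteq> {} \<and>
      ediam (\<lambda>x y. norm (x - y)) (A \<inter> H) < ennreal \<epsilon>"
    by (meson order_le_less_trans)
qed

end
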